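(* Let $k\geq 2$ be an integer, let $G$ be a graph with $\delta(G)\geq k-1$, and let $m\geq k$ be an integer. Then $\gamma_{\times k}^{r}(G)=m$ if and only if $m$ is the smallest positive integer $m'$ with the following property: $G$ is isomorphic to some graph $K'$ on $m'$ vertices with $\delta(K')\geq k-1$ (i.e. a spanning subgraph of $K_{m'}$ with minimum degree at least $k-1$), or $G$ is isomorphic to $F\circ_k K'$ for some graph $F$ with $\delta(F)\geq k$ and some graph $K'$ on $m'$ vertices with $\delta(K')\geq k-1$.
   Context: All graphs are finite, simple and undirected. For a graph $G=(V,E)$ and $x\in V$, $N[x]$ is the closed neighborhood. For a graph $G$ with $\delta(G)\geq k-1$: a set $S\subseteq V$ is a $k$-tuple dominating set if $|N[x]\cap S|\geq k$ for all $x\in V$; it is a $k$-tuple restrained dominating set if moreover every vertex of $V-S$ has at least $k$ neighbors in $V-S$; $\gamma_{\times k}^{r}(G)$ is the minimum cardinality of such a set. For graphs $F$ and $H$ with $|V(H)|\geq k$, a $k$-join $F\circ_k H$ is any graph obtained from the disjoint union of $F$ and $H$ by joining each vertex of $F$ to at least $k$ vertices of $H$ (no other edges are added). *)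

theory Defs
  imports "Graph_Theory.Pair_Digraph" "Graph_Theory.Digraph_Isomorphism"
begin

text \<open>A finite simple undirected graph is a finite symmetric loop-free relation on its vertex set.
  Graphs are taken to be nonempty, as otherwise the minimum degree is meaningless.\<close>

definition simple_graph :: "'a pair_pre_digraph \<Rightarrow> bool" where
  "simple_graph G \<longleftrightarrow> pair_graph G \<and> pverts G \<noteq> {}"

definition neighbors :: "'a pair_pre_digraph \<Rightarrow> 'a \<Rightarrow> 'a set" where
  "neighbors G x = {y \<in> pverts G. (x, y) \<in> parcs G}"

definition closed_neighborhood :: "'a pair_pre_digraph \<Rightarrow> 'a \<Rightarrow> 'a set" where
  "closed_neighborhood G x = insert x (neighbors G x)"

definition min_degree :: "'a pair_pre_digraph \<Rightarrow> nat" where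
  "min_degree G = Min ((\<lambda>x. card (neighbors G x)) ` pverts G)"

definition ktuple_dominating :: "nat \<Rightarrow> 'a pair_pre_digraph \<Rightarrow> 'a set \<Rightarrow> bool" where
  "ktuple_dominating k G S \<longleftrightarrow>
     S \<subseteq> pverts G \<and> (\<forall>x\<in>pverts G. k \<le> card (closed_neighborhood G x \<inter> S))"

definition ktuple_restrained_dominating :: "nat \<Rightarrow> 'a pair_pre_digraph \<Rightarrow> 'a set \<Rightarrow> bool" where
  "ktuple_restrained_dominating k G S \<longleftrightarrow>
     ktuple_dominating k G S \<and>
     (\<forall>x\<in>pverts G - S. k \<le> card (neighbors G x \<inter> (pverts G - S)))"

text \<open>The minimum is over a nonempty set whenever the minimum degree is at least \<open>k - 1\<close>,
  since then the full vertex set is a \<open>k\<close>-tuple restrained dominating set.\<close>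

definition ktuple_restrained_domination_number :: "nat \<Rightarrow> 'a pair_pre_digraph \<Rightarrow> nat" where
  "ktuple_restrained_domination_number k G =
     Min (card ` {S. ktuple_restrained_dominating k G S})"

definition graph_iso :: "'a pair_pre_digraph \<Rightarrow> 'b pair_pre_digraph \<Rightarrow> bool" where
  "graph_iso G H \<longleftrightarrow> digraph_iso (with_proj G) (with_proj H)"

text \<open>\<open>J\<close> is one of the \<open>k\<close>-joins of \<open>F\<close> and \<open>H\<close>; the disjoint union of the vertex sets is
  the tagged one.\<close>

definition is_k_join ::
    "nat \<Rightarrow> 'a pair_pre_digraph \<Rightarrow> 'b pair_pre_digraph \<Rightarrow> ('a + 'b) pair_pre_digraph \<Rightarrow> bool" where
  "is_k_join k F H J \<longleftrightarrow>
     k \<le> card (pverts H) \<and>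
     simple_graph J \<and>
     pverts J = pverts F <+> pverts H \<and>
     (\<forall>u v. (Inl u, Inl v) \<in> parcs J \<longleftrightarrow> (u, v) \<in> parcs F) \<and>
     (\<forall>u v. (Inr u, Inr v) \<in> parcs J \<longleftrightarrow> (u, v) \<in> parcs H) \<and>
     (\<forall>u\<in>pverts F. k \<le> card {v \<in> pverts H. (Inl u, Inr v) \<in> parcs J})"

text \<open>\<open>F\<close> and \<open>K'\<close> range over graphs with vertices in \<^typ>\<open>nat\<close>, which covers every finite graph
  up to isomorphism.\<close>

definition decomposition_property :: "nat \<Rightarrow> 'a pair_pre_digraph \<Rightarrow> nat \<Rightarrow> bool" where
  "decomposition_property k G m \<longleftrightarrow>
     (\<exists>K' :: nat pair_pre_digraph.
        simple_graph K' \<and> card (pverts K') = m \<and> k - 1 \<le> min_degree K' \<and> graph_iso G K') \<or>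
     (\<exists>(F :: nat pair_pre_digraph) (K' :: nat pair_pre_digraph) J.
        simple_graph F \<and> k \<le> min_degree F \<and>
        simple_graph K' \<and> card (pverts K') = m \<and> k - 1 \<le> min_degree K' \<and>
        is_k_join k F K' J \<and> graph_iso G J)"

end

(* A k-tuple restrained dominating set S splits G into the graph K' induced on S and the graph F
   induced on V - S: each vertex of S counts itself, so domination inside S says that K' has
   minimum degree at least k - 1, domination outside S says that G is a k-join of F and K', and
   restrainedness says that F has minimum degree at least k. When S = V, the graph F is empty,
   which gives the first alternative of the decomposition property. Hence the m' that admit a
   decomposition are exactly the cardinalities of k-tuple restrained dominating sets. *)

theory Submission
  imports Defs
begin

section \<open>Simple graphs as relations; domination in terms of open neighborhoods\<close>

lemma simple_graph_iff:
  "simple_graph G \<longleftrightarrow> finite (pverts G) \<and> pverts G \<noteq> {} \<and> parcs G \<subseteq> pverts G \<times> pverts G \<and>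
     sym (parcs G) \<and> irrefl (parcs G)"
proof
  assume "simple_graph G"
  then interpret pair_graph G by (simp add: simple_graph_def)
  show "finite (pverts G) \<and> pverts G \<noteq> {} \<and> parcs G \<subseteq> pverts G \<times> pverts G \<and>
     sym (parcs G) \<and> irrefl (parcs G)"
    using \<open>simple_graph G\<close> pair_finite_verts
    by (auto simp: simple_graph_def sym_def irrefl_def dest: in_arcsD1 in_arcsD2 no_loops'
        intro: arcs_symmetric)
next
  assume R: "finite (pverts G) \<and> pverts G \<noteq> {} \<and> parcs G \<subseteq> pverts G \<times> pverts G \<and>
     sym (parcs G) \<and> irrefl (parcs G)"
  then have "finite (parcs G)"
    using finite_subset by blast
  with R have "pair_graph G"
    by unfold_locales (auto simp: symmetric_def irrefl_def)
  with R show "simple_graph G"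
    by (simp add: simple_graph_def)
qed

lemma neighbors_subset: "neighbors G x \<subseteq> pverts G"
  by (auto simp: neighbors_def)

lemma finite_neighbors: "simple_graph G \<Longrightarrow> finite (neighbors G x)"
  by (meson finite_subset neighbors_subset simple_graph_iff)

lemma not_in_neighbors_self: "simple_graph G \<Longrightarrow> x \<notin> neighbors G x"
  by (auto simp: neighbors_def simple_graph_iff irrefl_def)

lemma le_min_degree_iff:
  "simple_graph G \<Longrightarrow> d \<le> min_degree G \<longleftrightarrow> (\<forall>x\<in>pverts G. d \<le> card (neighbors G x))"
  by (simp add: min_degree_def simple_graph_iff)

lemma card_closed_neighborhood_Int:
  assumes "simple_graph G"
  shows "card (closed_neighborhood G x \<inter> S) =
    (if x \<in> S then Suc (card (neighbors G x \<inter> S)) else card (neighbors G x \<inter> S))"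
  using finite_neighbors[OF assms] not_in_neighbors_self[OF assms]
  by (auto simp: closed_neighborhood_def)

text \<open>Removing \<open>x\<close> from its closed neighborhood lowers the bound by one exactly
  when \<open>x\<close> lies in \<open>S\<close>. What is left are degree conditions on the
  subgraphs induced on \<open>S\<close> and on its complement, plus a count of the edges
  across.\<close>

lemma ktuple_restrained_dominating_iff:
  assumes "simple_graph G"
  shows "ktuple_restrained_dominating k G S \<longleftrightarrow> S \<subseteq> pverts G \<and>
    (\<forall>x\<in>S. k - 1 \<le> card (neighbors G x \<inter> S)) \<and>
    (\<forall>x\<in>pverts G - S. k \<le> card (neighbors G x \<inter> S) \<and> k \<le> card (neighbors G x - S))"
proof -
  have "neighbors G x \<inter> (pverts G - S) = neighbors G x - S" for x
    using neighbors_subset by fastforce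
  \<comment> \<open>This also covers \<open>k = 0\<close>, where the subtraction truncates.\<close>
  moreover have "k - 1 \<le> n \<longleftrightarrow> k \<le> Suc n" for n by auto
  ultimately show ?thesis
    unfolding ktuple_restrained_dominating_def ktuple_dominating_def
    by (auto simp: card_closed_neighborhood_Int[OF assms])
qed

section \<open>Induced subgraphs and relabelling of vertices\<close>

definition induced :: "'a pair_pre_digraph \<Rightarrow> 'a set \<Rightarrow> 'a pair_pre_digraph" where
  "induced G A = \<lparr>pverts = A, parcs = parcs G \<inter> A \<times> A\<rparr>"

lemma pverts_induced [simp]: "pverts (induced G A) = A"
  by (simp add: induced_def)

lemma simple_graph_induced:
  "simple_graph G \<Longrightarrow> A \<subseteq> pverts G \<Longrightarrow> A \<noteq> {} \<Longrightarrow> simple_graph (induced G A)"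
  by (auto simp: simple_graph_iff induced_def sym_def irrefl_def finite_subset)

lemma neighbors_induced:
  "A \<subseteq> pverts G \<Longrightarrow> x \<in> A \<Longrightarrow> neighbors (induced G A) x = neighbors G x \<inter> A"
  by (auto simp: neighbors_def induced_def)

text \<open>\<open>h\<close> need not be injective here; injectivity on \<open>pverts G\<close> is
  imposed wherever the result is to be an isomorphic copy.\<close>

definition relabel :: "('a \<Rightarrow> 'b) \<Rightarrow> 'a pair_pre_digraph \<Rightarrow> 'b pair_pre_digraph" where
  "relabel h G = \<lparr>pverts = h ` pverts G, parcs = map_prod h h ` parcs G\<rparr>"

lemma pverts_relabel [simp]: "pverts (relabel h G) = h ` pverts G"
  by (simp add: relabel_def)

text \<open>Arcs are pairs of vertices, so the vertex map of an isomorphism determines its arc map,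
  and one injection carries all the information.\<close>

lemma graph_iso_iff:
  assumes "simple_graph G"
  shows "graph_iso G H \<longleftrightarrow> (\<exists>h. inj_on h (pverts G) \<and> H = relabel h G)"
proof
  assume "graph_iso G H"
  then obtain f where f: "pre_digraph.digraph_isomorphism (with_proj G) f"
    and H: "with_proj H = app_iso f (with_proj G)"
    by (auto simp: graph_iso_def digraph_iso_def)
  \<comment> \<open>Tail and head of \<open>with_proj H\<close> are the projections, which forces
    \<open>iso_tail f = fst\<close> and \<open>iso_head f = snd\<close>. Compatibility with tail and
    head then makes \<open>iso_arcs f\<close> act componentwise.\<close>
  from H have V: "pverts H = iso_verts f ` pverts G" and A: "parcs H = iso_arcs f ` parcs G"
    and t: "iso_tail f = fst" and h: "iso_head f = snd"
    by (simp_all add: with_proj_def app_iso_def)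
  have "iso_arcs f e = map_prod (iso_verts f) (iso_verts f) e" if "e \<in> parcs G" for e
    using f that t h by (auto simp: pre_digraph.digraph_isomorphism_def prod_eq_iff)
  then have "parcs H = map_prod (iso_verts f) (iso_verts f) ` parcs G"
    using A by simp
  then have "H = relabel (iso_verts f) G"
    using V by (simp add: relabel_def)
  moreover have "inj_on (iso_verts f) (pverts G)"
    using f by (simp add: pre_digraph.digraph_isomorphism_def)
  ultimately show "\<exists>h. inj_on h (pverts G) \<and> H = relabel h G"
    by blast
next
  assume "\<exists>h. inj_on h (pverts G) \<and> H = relabel h G"
  then obtain h where h: "inj_on h (pverts G)" and H: "H = relabel h G"
    by blast
  define f where
    "f = \<lparr>iso_verts = h, iso_arcs = map_prod h h, iso_head = snd, iso_tail = fst\<rparr>"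
  have sub: "parcs G \<subseteq> pverts G \<times> pverts G"
    using assms by (simp add: simple_graph_iff)
  have "wf_digraph (with_proj G)"
    using sub by unfold_locales auto
  moreover have "inj_on (map_prod h h) (parcs G)"
    using map_prod_inj_on[OF h h] sub by (rule inj_on_subset)
  ultimately have "pre_digraph.digraph_isomorphism (with_proj G) f"
    using h by (simp add: pre_digraph.digraph_isomorphism_def f_def)
  moreover have "with_proj H = app_iso f (with_proj G)"
    by (simp add: H relabel_def with_proj_def app_iso_def f_def)
  ultimately show "graph_iso G H"
    by (auto simp: graph_iso_def digraph_iso_def)
qed

context
  fixes G :: "'a pair_pre_digraph" and h :: "'a \<Rightarrow> 'b"
  assumes G: "simple_graph G" and h: "inj_on h (pverts G)"
begin

lemma parcs_relabel_iff:
  assumes "x \<in> pverts G" "y \<in> pverts G"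
  shows "(h x, h y) \<in> parcs (relabel h G) \<longleftrightarrow> (x, y) \<in> parcs G"
proof
  assume "(h x, h y) \<in> parcs (relabel h G)"
  then obtain a b where ab: "(a, b) \<in> parcs G" "h x = h a" "h y = h b"
    by (auto simp: relabel_def)
  then have "a \<in> pverts G" "b \<in> pverts G"
    using G by (auto simp: simple_graph_iff)
  then have "x = a" "y = b"
    using ab assms h by (auto dest: inj_onD)
  then show "(x, y) \<in> parcs G"
    using ab by simp
qed (auto simp: relabel_def)

lemma simple_graph_relabel: "simple_graph (relabel h G)"
proof -
  have arcs: "parcs G \<subseteq> pverts G \<times> pverts G" and "irrefl (parcs G)"
    using G by (simp_all add: simple_graph_iff)
  then have "(a, a) \<notin> parcs (relabel h G)" for a
    using parcs_relabel_iff by (fastforce simp: relabel_def irrefl_def dest: inj_onD[OF h])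
  moreover have "sym (parcs (relabel h G))"
    using G by (force simp: relabel_def simple_graph_iff sym_def)
  moreover have "parcs (relabel h G) \<subseteq> h ` pverts G \<times> h ` pverts G"
    using arcs by (auto simp: relabel_def)
  ultimately show ?thesis
    using G by (simp add: simple_graph_iff irrefl_def)
qed

lemma neighbors_relabel:
  assumes "x \<in> pverts G"
  shows "neighbors (relabel h G) (h x) = h ` neighbors G x"
  using assms parcs_relabel_iff by (auto simp: neighbors_def)

lemma card_neighbors_relabel_Int:
  assumes "x \<in> pverts G" "S \<subseteq> pverts G"
  shows "card (neighbors (relabel h G) (h x) \<inter> h ` S) = card (neighbors G x \<inter> S)"
proof -
  have "neighbors (relabel h G) (h x) \<inter> h ` S = h ` (neighbors G x \<inter> S)"
    using assms by (simp add: neighbors_relabel inj_on_image_Int[OF h] neighbors_subset)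
  moreover have "inj_on h (neighbors G x \<inter> S)"
    by (rule inj_on_subset[OF h]) (use assms in auto)
  ultimately show ?thesis
    by (simp add: card_image)
qed

lemma card_neighbors_relabel:
  assumes "x \<in> pverts G"
  shows "card (neighbors (relabel h G) (h x)) = card (neighbors G x)"
  using card_neighbors_relabel_Int[OF assms subset_refl] neighbors_subset[of G x]
    neighbors_subset[of "relabel h G" "h x"]
  by (simp add: Int_absorb2)

text \<open>This direction serves to pull dominating sets of \<open>K'\<close> or of a join back to
  \<open>G\<close>.\<close>

lemma ktuple_restrained_dominating_relabel:
  assumes "ktuple_restrained_dominating k (relabel h G) (h ` S)" "S \<subseteq> pverts G"
  shows "ktuple_restrained_dominating k G S"
proof -
  \<comment> \<open>A difference has the size of the whole neighborhood minus that of its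
    intersection with the set, and relabelling preserves both.\<close>
  have eq: "card (neighbors (relabel h G) (h x) - h ` S) = card (neighbors G x - S)"
    if "x \<in> pverts G" for x
    using card_neighbors_relabel_Int[OF that assms(2)] card_neighbors_relabel[OF that]
    by (simp add: card_Diff_subset_Int finite_neighbors G simple_graph_relabel)
  have "h ` pverts G - h ` S = h ` (pverts G - S)"
    using assms(2) by (simp add: inj_on_image_set_diff[OF h])
  then have "\<forall>x\<in>S. k - 1 \<le> card (neighbors (relabel h G) (h x) \<inter> h ` S)"
    "\<forall>x\<in>pverts G - S. k \<le> card (neighbors (relabel h G) (h x) \<inter> h ` S) \<and>
       k \<le> card (neighbors (relabel h G) (h x) - h ` S)"
    using assms(1) by (simp_all add: ktuple_restrained_dominating_iff simple_graph_relabel)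
  then show ?thesis
    using assms(2) eq card_neighbors_relabel_Int[OF _ assms(2)]
    by (simp add: ktuple_restrained_dominating_iff[OF G] subset_iff)
qed

lemma le_min_degree_relabel_iff: "d \<le> min_degree (relabel h G) \<longleftrightarrow> d \<le> min_degree G"
  by (simp add: le_min_degree_iff G simple_graph_relabel card_neighbors_relabel)

end

section \<open>Dominating sets obtained from decompositions\<close>

lemma ktuple_restrained_dominating_pverts:
  assumes "simple_graph G" "k - 1 \<le> min_degree G"
  shows "ktuple_restrained_dominating k G (pverts G)"
  using assms
  by (simp add: ktuple_restrained_dominating_iff le_min_degree_iff Int_absorb2 neighbors_subset)

lemma ktuple_restrained_dominating_k_join:
  assumes F: "simple_graph F" "k \<le> min_degree F"
    and K: "simple_graph K" "k - 1 \<le> min_degree K"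
    and J: "is_k_join k F K J"
  shows "ktuple_restrained_dominating k J (Inr ` pverts K)"
proof -
  have V: "pverts J = Inl ` pverts F \<union> Inr ` pverts K" and sJ: "simple_graph J"
    using J by (auto simp: is_k_join_def Plus_def)
  \<comment> \<open>The three neighborhoods match the three bounds to be checked: degrees in
    \<open>K\<close>, edges from \<open>F\<close> into \<open>K\<close>, and degrees in
    \<open>F\<close>.\<close>
  have "neighbors J (Inr x) \<inter> Inr ` pverts K = Inr ` neighbors K x" for x
    using J by (auto simp: neighbors_def V is_k_join_def)
  moreover have "neighbors J (Inl x) \<inter> Inr ` pverts K =
      Inr ` {v \<in> pverts K. (Inl x, Inr v) \<in> parcs J}" for x
    by (auto simp: neighbors_def V)
  moreover have "neighbors J (Inl x) - Inr ` pverts K = Inl ` neighbors F x" for x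
    using J by (auto simp: neighbors_def V is_k_join_def)
  ultimately show ?thesis
    unfolding ktuple_restrained_dominating_iff[OF sJ]
    using F K J by (auto simp: V card_image le_min_degree_iff is_k_join_def)
qed

section \<open>Decompositions obtained from dominating sets\<close>

lemma ktuple_restrained_dominating_card_ge:
  assumes G: "simple_graph G" and S: "ktuple_restrained_dominating k G S"
  shows "k \<le> card S"
proof -
  obtain x where "x \<in> pverts G"
    using G by (auto simp: simple_graph_iff)
  then have "k \<le> card (closed_neighborhood G x \<inter> S)"
    using S by (simp add: ktuple_restrained_dominating_def ktuple_dominating_def)
  also have "\<dots> \<le> card S"
    using G S by (intro card_mono)
      (auto simp: ktuple_restrained_dominating_def ktuple_dominating_def simple_graph_iff
        finite_subset)
  finally show ?thesis .
qed

lemma decomposition_property_card: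
  fixes G :: "'a pair_pre_digraph"
  assumes k: "0 < k" and G: "simple_graph G" and S: "ktuple_restrained_dominating k G S"
  shows "decomposition_property k G (card S)"
proof -
  have fin: "finite (pverts G)"
    using G by (simp add: simple_graph_iff)
  \<comment> \<open>The decomposition property asks for graphs on \<open>nat\<close>. One injection
    serves for both parts, since the tags of the disjoint union keep them apart.\<close>
  then obtain f :: "'a \<Rightarrow> nat" where f: "inj_on f (pverts G)"
    using finite_imp_inj_to_nat_seg[of "pverts G"] by metis
  have sub: "S \<subseteq> pverts G"
    and inS: "\<And>x. x \<in> S \<Longrightarrow> k - 1 \<le> card (neighbors G x \<inter> S)"
    and outS: "\<And>x. x \<in> pverts G - S \<Longrightarrow> k \<le> card (neighbors G x \<inter> S)"
      "\<And>x. x \<in> pverts G - S \<Longrightarrow> k \<le> card (neighbors G x - S)"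
    using S by (auto simp: ktuple_restrained_dominating_iff[OF G])
  \<comment> \<open>This bound is itself a clause of the \<open>k\<close>-join; with
    \<open>0 < k\<close> it also makes \<open>S\<close> nonempty, so that the graph induced on
    \<open>S\<close> is a simple graph.\<close>
  have kS: "k \<le> card S"
    using ktuple_restrained_dominating_card_ge[OF G S] .
  then have ne: "S \<noteq> {}"
    using k by auto
  have fS: "inj_on f S" and fD: "inj_on f (pverts G - S)"
    using inj_on_subset[OF f] sub by simp_all
  define K where "K = relabel f (induced G S)"
  have iS: "simple_graph (induced G S)"
    using G sub ne by (rule simple_graph_induced)
  then have "k - 1 \<le> min_degree (induced G S)"
    using inS sub by (simp add: le_min_degree_iff neighbors_induced)
  then have K: "simple_graph K" "card (pverts K) = card S" "k - 1 \<le> min_degree K"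
    using iS fS
    by (simp_all add: K_def simple_graph_relabel card_image le_min_degree_relabel_iff)
  show ?thesis
  proof (cases "S = pverts G")
    case True
    have "parcs G \<inter> S \<times> S = parcs G"
      using True G by (auto simp: simple_graph_iff)
    then have "induced G S = G"
      using True by (simp add: induced_def)
    then have "graph_iso G K"
      using f G by (auto simp: graph_iso_iff K_def)
    then show ?thesis
      using K by (auto simp: decomposition_property_def)
  next
    case False
    define F where "F = relabel f (induced G (pverts G - S))"
    \<comment> \<open>\<open>g\<close> is \<open>f\<close> with a tag recording the side of each
      vertex. Taking \<open>J\<close> as the copy of \<open>G\<close> under \<open>g\<close> makes
      the isomorphism immediate and leaves only the clauses of the \<open>k\<close>-join.\<close>
    define g where "g = (\<lambda>x. if x \<in> S then Inr (f x) else Inl (f x) :: nat + nat)"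
    define J where "J = relabel g G"
    have iD: "simple_graph (induced G (pverts G - S))"
      using False sub by (intro simple_graph_induced G) auto
    moreover have "neighbors G x \<inter> (pverts G - S) = neighbors G x - S" for x
      using neighbors_subset by fastforce
    ultimately have "k \<le> min_degree (induced G (pverts G - S))"
      using outS(2) by (simp add: le_min_degree_iff neighbors_induced)
    then have F: "simple_graph F" "k \<le> min_degree F"
      using iD fD by (simp_all add: F_def simple_graph_relabel le_min_degree_relabel_iff)
    have g: "inj_on g (pverts G)"
      using f by (auto simp: g_def inj_on_def)
    have arcs: "parcs G \<subseteq> pverts G \<times> pverts G"
      using G by (simp add: simple_graph_iff)
    have Inl_g: "Inl u = g x \<longleftrightarrow> x \<notin> S \<and> u = f x" and Inr_g: "Inr u = g x \<longleftrightarrow> x \<in> S \<and> u = f x"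
      for u x by (auto simp: g_def)
    have parcs_J: "(p, q) \<in> parcs J \<longleftrightarrow> (\<exists>x y. (x, y) \<in> parcs G \<and> p = g x \<and> q = g y)" for p q
      by (auto simp: J_def relabel_def)
    \<comment> \<open>The conditions are grouped as in \<open>Inl_g\<close> and
      \<open>Inr_g\<close>, so that rewriting turns the arcs of \<open>J\<close> within one side
      literally into those of \<open>F\<close> or \<open>K\<close>. Membership in
      \<open>pverts G\<close> can be left out because it follows from \<open>arcs\<close>.\<close>
    have parcs_F: "(u, v) \<in> parcs F \<longleftrightarrow>
        (\<exists>x y. (x, y) \<in> parcs G \<and> (x \<notin> S \<and> u = f x) \<and> (y \<notin> S \<and> v = f y))" for u v
      using arcs by (auto simp: F_def relabel_def induced_def)
    have parcs_K: "(u, v) \<in> parcs K \<longleftrightarrow>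
        (\<exists>x y. (x, y) \<in> parcs G \<and> (x \<in> S \<and> u = f x) \<and> (y \<in> S \<and> v = f y))" for u v
      by (auto simp: K_def relabel_def induced_def)
    have "is_k_join k F K J"
      unfolding is_k_join_def
    proof (intro conjI allI ballI)
      show "k \<le> card (pverts K)"
        using K kS by simp
      show "simple_graph J"
        using G g by (simp add: J_def simple_graph_relabel)
      show "pverts J = pverts F <+> pverts K"
        using sub by (auto simp: J_def F_def K_def g_def)
      show "(Inl u, Inl v) \<in> parcs J \<longleftrightarrow> (u, v) \<in> parcs F" for u v
        by (simp only: parcs_J parcs_F Inl_g)
      show "(Inr u, Inr v) \<in> parcs J \<longleftrightarrow> (u, v) \<in> parcs K" for u v
        by (simp only: parcs_J parcs_K Inr_g)
      fix u assume "u \<in> pverts F"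
      then obtain x where x: "x \<in> pverts G" "x \<notin> S" "u = f x"
        by (auto simp: F_def)
      \<comment> \<open>The vertices of \<open>K\<close> joined to \<open>u\<close> are thus the
        copies of the neighbors of \<open>x\<close> in \<open>S\<close>, and domination of
        \<open>x\<close> provides at least \<open>k\<close> of them.\<close>
      have "(Inl (f x), Inr (f y)) \<in> parcs J \<longleftrightarrow> (x, y) \<in> parcs G" if "y \<in> S" for y
        using parcs_relabel_iff[OF G g, of x y] x that sub by (auto simp: J_def g_def)
      then have "{v \<in> pverts K. (Inl u, Inr v) \<in> parcs J} = f ` (neighbors G x \<inter> S)"
        using sub by (auto simp: K_def x neighbors_def)
      moreover have "inj_on f (neighbors G x \<inter> S)"
        using fS by (rule inj_on_subset) simp
      ultimately show "k \<le> card {v \<in> pverts K. (Inl u, Inr v) \<in> parcs J}"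
        using outS(1) x by (simp add: card_image)
    qed
    moreover have "graph_iso G J"
      using g G by (auto simp: graph_iso_iff J_def)
    ultimately show ?thesis
      using K F unfolding decomposition_property_def by blast
  qed
qed

section \<open>Decomposition sizes as cardinalities, and their minimum\<close>

lemma decomposition_property_iff:
  assumes k: "0 < k" and G: "simple_graph G"
  shows "decomposition_property k G m \<longleftrightarrow>
    (\<exists>S. ktuple_restrained_dominating k G S \<and> card S = m)"
proof
  \<comment> \<open>The vertex type of \<open>H\<close> is left general: the first alternative uses
    this for \<open>K\<close> on \<open>nat\<close>, the second for \<open>J\<close> on
    \<open>nat + nat\<close>.\<close>
  have pullback: "\<exists>S. ktuple_restrained_dominating k G S \<and> card S = card T"
    if iso: "graph_iso G H" and T: "ktuple_restrained_dominating k H T"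
    for H :: "'c pair_pre_digraph" and T
  proof -
    obtain h where h: "inj_on h (pverts G)" and H: "H = relabel h G"
      using iso by (auto simp: graph_iso_iff[OF G])
    have "T \<subseteq> h ` pverts G"
      using T H by (simp add: ktuple_restrained_dominating_def ktuple_dominating_def)
    then obtain S where S: "S \<subseteq> pverts G" "T = h ` S"
      by (auto simp: subset_image_iff)
    then have "card S = card T"
      using h by (metis card_image inj_on_subset)
    then show ?thesis
      using ktuple_restrained_dominating_relabel[OF G h] T S H by blast
  qed
  assume "decomposition_property k G m"
  then consider (whole) K :: "nat pair_pre_digraph" where
      "simple_graph K" "card (pverts K) = m" "k - 1 \<le> min_degree K" "graph_iso G K"
    | (join) F K :: "nat pair_pre_digraph" and J where
      "simple_graph F" "k \<le> min_degree F" "simple_graph K" "card (pverts K) = m"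
      "k - 1 \<le> min_degree K" "is_k_join k F K J" "graph_iso G J"
    unfolding decomposition_property_def by blast
  then show "\<exists>S. ktuple_restrained_dominating k G S \<and> card S = m"
  proof cases
    case whole
    then show ?thesis
      using pullback ktuple_restrained_dominating_pverts by metis
  next
    case join
    then have "\<exists>S. ktuple_restrained_dominating k G S \<and>
        card S = card (Inr ` pverts K :: (nat + nat) set)"
      by (intro pullback[of J] ktuple_restrained_dominating_k_join)
    then show ?thesis
      using join by (simp add: card_image)
  qed
next
  assume "\<exists>S. ktuple_restrained_dominating k G S \<and> card S = m"
  then show "decomposition_property k G m"
    using decomposition_property_card[OF k G] by blast
qed

theorem theorem3p1:
  fixes G :: "'a pair_pre_digraph" and k m :: nat
  assumes "k \<ge> 2"
    and "simple_graph G"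
    and "min_degree G \<ge> k - 1"
    and "m \<ge> k"
  shows "ktuple_restrained_domination_number k G = m \<longleftrightarrow>
    (0 < m \<and> decomposition_property k G m \<and>
     (\<forall>m'. 0 < m' \<and> decomposition_property k G m' \<longrightarrow> m \<le> m'))"
proof -
  let ?C = "card ` {S. ktuple_restrained_dominating k G S}"
  have dec: "decomposition_property k G n \<longleftrightarrow> n \<in> ?C" for n
    using assms(1,2) by (auto simp: decomposition_property_iff)
  \<comment> \<open>\<open>Min\<close> is characterized only on finite nonempty sets. Finiteness
    comes from the finitely many subsets of the vertex set, nonemptiness from the full vertex set
    and the minimum degree of \<open>G\<close>.\<close>
  have "{S. ktuple_restrained_dominating k G S} \<subseteq> Pow (pverts G)"
    by (auto simp: ktuple_restrained_dominating_def ktuple_dominating_def)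
  then have "finite {S. ktuple_restrained_dominating k G S}"
    by (rule finite_subset) (use assms(2) in \<open>simp add: simple_graph_iff\<close>)
  then have "finite ?C"
    by (rule finite_imageI)
  moreover have "?C \<noteq> {}"
    using ktuple_restrained_dominating_pverts[OF assms(2,3)] by blast
  ultimately have "Min ?C = m \<longleftrightarrow> m \<in> ?C \<and> (\<forall>n\<in>?C. m \<le> n)"
    by (rule Min_eq_iff)
  \<comment> \<open>Every dominating set has at least \<open>k\<close> \<ge> 2 elements, which
    supplies the positivity of \<open>m\<close> and of each competing \<open>m'\<close>.\<close>
  moreover have "0 < n" if "n \<in> ?C" for n
    using that ktuple_restrained_dominating_card_ge[OF assms(2), of k] assms(1) by fastforce
  ultimately show ?thesis
    unfolding ktuple_restrained_domination_number_def dec by blast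
qed

end
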